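(* Let $F$ be a field of prime characteristic $p$. Suppose that $r,s\geq1$ are integers and $V_r\otimes V_s=\bigoplus_{i=1}^{t}m_iV_{\mu_i}$, where $\mu_1>\cdots>\mu_t>0$ are the distinct part sizes and $m_1,\dots,m_t>0$ are their respective multiplicities. Then the multiplicities $m_1,\dots,m_t$ determine the part sizes $\mu_1>\cdots>\mu_t>0$, and conversely, via $$\mu_i=r+s-m_i-2\sum_{j=1}^{i-1}m_j\qquad\text{for }1\leq i\leq t,$$ $$m_i=(-1)^{i-1}\left[r+s+2\sum_{j=1}^{i-1}(-1)^{j}\mu_j\right]-\mu_i\qquad\text{for }1\leq i\leq t.$$
   Context: $F$ is a field of prime characteristic $p$. $J_r(1)$ denotes the $r\times r$ Jordan block over $F$ with eigenvalue $1$. For $r\le p^n$, $V_r$ is the indecomposable $r$-dimensional module over $F$ of the cyclic group $C_{p^n}$ on which a fixed generator acts as $J_r(1)$ (regarded as a module for every $C_{p^n}$ with $p^n\geq r$). $mV$ denotes the direct sum of $m$ copies of $V$. The module decomposition $V_r\otimes V_s=\bigoplus_{i=1}^t m_iV_{\mu_i}$ (up to isomorphism, for any $n$ with $\max(r,s)\leq p^n$) is equivalent to saying that the Jordan canonical form of $J_r(1)\otimes J_s(1)$ over $F$ has exactly $m_i$ blocks of size $\mu_i$ for each $i$, and no other blocks. *)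

theory Defs
  imports
    "HOL-Algebra.Elementary_Groups"
    "HOL-Computational_Algebra.Primes"
    "Jordan_Normal_Form.Jordan_Normal_Form"
begin

text \<open>
  Finite-dimensional modules over a field for a group \<open>G\<close> are given as matrix representations,
  i.e. as functions from \<open>carrier G\<close> to square matrices.  The dimension of the module is the size
  of the matrices.
\<close>

definition mat_rep :: "('g, 'b) monoid_scheme \<Rightarrow> nat \<Rightarrow> ('g \<Rightarrow> 'a::field mat) \<Rightarrow> bool" where
  "mat_rep G d \<rho> \<longleftrightarrow>
     (\<forall>g\<in>carrier G. \<rho> g \<in> carrier_mat d d) \<and>
     \<rho> \<one>\<^bsub>G\<^esub> = 1\<^sub>m d \<and>
     (\<forall>g\<in>carrier G. \<forall>h\<in>carrier G. \<rho> (g \<otimes>\<^bsub>G\<^esub> h) = \<rho> g * \<rho> h)"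

text \<open>One change of basis has to intertwine the action of all group elements simultaneously.\<close>

definition rep_iso :: "('g, 'b) monoid_scheme \<Rightarrow> ('g \<Rightarrow> 'a::field mat) \<Rightarrow> ('g \<Rightarrow> 'a mat) \<Rightarrow> bool" where
  "rep_iso G \<rho> \<sigma> \<longleftrightarrow> (\<exists>P Q. \<forall>g\<in>carrier G. similar_mat_wit (\<rho> g) (\<sigma> g) P Q)"

text \<open>The Kronecker product, with respect to the basis \<open>e\<^sub>i \<otimes> f\<^sub>k\<close> in lexicographic order.\<close>

definition kronecker_mat :: "'a::semiring_1 mat \<Rightarrow> 'a mat \<Rightarrow> 'a mat" where
  "kronecker_mat A B = mat (dim_row A * dim_row B) (dim_col A * dim_col B)
     (\<lambda>(i, j). A $$ (i div dim_row B, j div dim_col B) * B $$ (i mod dim_row B, j mod dim_col B))"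

definition tensor_rep :: "('g \<Rightarrow> 'a::field mat) \<Rightarrow> ('g \<Rightarrow> 'a mat) \<Rightarrow> 'g \<Rightarrow> 'a mat" where
  "tensor_rep \<rho> \<sigma> g = kronecker_mat (\<rho> g) (\<sigma> g)"

definition direct_sum_rep :: "('g \<Rightarrow> 'a::field mat) list \<Rightarrow> 'g \<Rightarrow> 'a mat" where
  "direct_sum_rep \<rho>s g = diag_block_mat (map (\<lambda>\<rho>. \<rho> g) \<rho>s)"

text \<open>
  The module \<open>V\<^sub>r\<close> for the cyclic group \<open>integer_mod_group N\<close> with carrier \<open>{0..<N}\<close>, whose generator
  \<open>1\<close> acts as the Jordan block \<open>J\<^sub>r(1)\<close>.  The function does not depend on \<open>N\<close>; it is a
  representation of the cyclic group of order \<open>p^n\<close> in characteristic \<open>p\<close> whenever \<open>r \<le> p^n\<close>,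
  see \<open>mat_rep_jordan_rep\<close>.
\<close>

definition jordan_rep :: "nat \<Rightarrow> int \<Rightarrow> 'a::field mat" where
  "jordan_rep r k = jordan_block r 1 ^\<^sub>m nat k"

lemma prime_dvd_prime_power_choose:
  fixes p :: nat
  assumes p: "prime p" and k: "0 < k" "k < p ^ n"
  shows "p dvd (p ^ n choose k)"
proof (rule ccontr)
  assume "\<not> p dvd (p ^ n choose k)"
  then have "coprime (p ^ n) (p ^ n choose k)"
    using p by (simp add: prime_imp_coprime)
  moreover have "p ^ n dvd k * (p ^ n choose k)"
    using times_binomial_minus1_eq[OF k(1), of "p ^ n"] by simp
  ultimately have "p ^ n dvd k"
    using coprime_dvd_mult_left_iff by blast
  with k show False
    by (meson dvd_imp_le not_le)
qed

lemma jordan_block_one_pow_char: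
  assumes p: "prime p" and char: "CHAR('a::field) = p" and r: "r \<le> p ^ n"
  shows "jordan_block r (1::'a) ^\<^sub>m (p ^ n) = 1\<^sub>m r"
proof -
  have "of_nat (p ^ n choose (j - i)) = (0::'a)" if "i < j" "j < r" for i j
    using prime_dvd_prime_power_choose[OF p, of "j - i" n] that r char
    by (auto simp: of_nat_eq_0_iff_char_dvd)
  then show ?thesis
    unfolding jordan_block_pow by (intro eq_matI) auto
qed

lemma mat_rep_jordan_rep:
  assumes p: "prime p" and char: "CHAR('a::field) = p" and r: "r \<le> p ^ n"
  shows "mat_rep (integer_mod_group (p ^ n)) r (jordan_rep r :: int \<Rightarrow> 'a mat)"
proof -
  let ?J = "jordan_block r (1::'a)"
  have J: "?J \<in> carrier_mat r r" by simp
  have N: "p ^ n > 0" using p by (simp add: prime_gt_0_nat)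
  have add: "?J ^\<^sub>m (a + b) = ?J ^\<^sub>m a * ?J ^\<^sub>m b" for a b
    by (induction b) (simp_all add: assoc_mult_mat[of _ r r _ r _ r])
  have "?J ^\<^sub>m ((p ^ n) * c) = 1\<^sub>m r" for c
    by (induction c) (simp_all add: add jordan_block_one_pow_char[OF p char r])
  then have per: "?J ^\<^sub>m (a mod (p ^ n)) = ?J ^\<^sub>m a" for a
    using add[of "p ^ n * (a div p ^ n)" "a mod p ^ n"] by simp
  have "?J ^\<^sub>m nat ((x + y) mod int (p ^ n)) = ?J ^\<^sub>m nat x * ?J ^\<^sub>m nat y"
    if "x \<ge> 0" "y \<ge> 0" for x y
  proof -
    have "nat ((x + y) mod int (p ^ n)) = (nat x + nat y) mod (p ^ n)"
      using that by (simp add: nat_mod_distrib nat_add_distrib flip: of_nat_power)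
    then show ?thesis by (simp only: per add)
  qed
  then show ?thesis
    using N by (auto simp: mat_rep_def jordan_rep_def carrier_integer_mod_group)
qed

end

theory Submission
  imports Defs "Jordan_Normal_Form.Jordan_Normal_Form_Uniqueness"
begin

text \<open>
  \<open>V\<^sub>r \<otimes> V\<^sub>s\<close> is \<open>A = F[x, y]/(x\<^sup>r, y\<^sup>s)\<close> with the generator acting as \<open>(1 + x) (1 + y) = 1 + Z\<close>.  In terms of
  \<open>X = x (1 + y)\<close> and \<open>Z\<close> the relations are \<open>X\<^sup>r = (Z - X)\<^sup>s = 0\<close>, so \<open>A\<close> is graded.  Write \<open>p\<^sup>h\<close> for the
  homogenization of \<open>p \<in> F[X]\<close> by \<open>Z\<close>.  If \<open>f\<close> and \<open>g\<close>, of degrees \<open>a \<ge> b\<close>, are consecutive remainders of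
  the Euclidean algorithm for \<open>X\<^sup>r\<close> and \<open>(1 - X)\<^sup>s\<close>, then \<open>Z\<^sup>l\<close> kills \<open>f\<^sup>h\<close> and \<open>g\<^sup>h\<close> for
  \<open>l = r + s - a - b\<close>.  Hence each \<open>X\<^sup>i g\<^sup>h\<close> with \<open>i < a - b\<close> starts a \<open>Z\<close>-string of length at most \<open>l\<close>.
  These strings span \<open>A\<close>, and the numbers \<open>l\<close> add up to \<open>r s\<close>, so the strings form a Jordan basis: each
  division step contributes \<open>a - b\<close> blocks of size \<open>r + s - a - b\<close>.  In particular the \<open>k\<close> blocks of size at
  least \<open>c\<close> have total size \<open>k (r + s - k)\<close> for every \<open>c\<close>, and this gives both formulas.
\<close>

section \<open>Euclidean descent\<close>


text \<open>In \<open>'a poly poly\<close> the outer variable is \<open>x\<close>, the inner one is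
  \<open>y\<close>, and \<open>[:[:c:]:]\<close> is the scalar \<open>c\<close>. The degree
  \<open>D\<close> is a separate argument so that polynomials of different degrees can be added in a
  common degree.\<close>

definition homogenize :: "'a::field poly poly \<Rightarrow> 'a poly poly \<Rightarrow> 'a poly \<Rightarrow> nat \<Rightarrow> 'a poly poly" where
  "homogenize X Z p D = (\<Sum>i\<le>D. [:[:coeff p i:]:] * X ^ i * Z ^ (D - i))"

lemma homogenize_0 [simp]: "homogenize X Z 0 D = 0"
  by (simp add: homogenize_def)

lemma homogenize_add: "homogenize X Z (p + q) D = homogenize X Z p D + homogenize X Z q D"
proof -
  have C: "[:[:a + b:]:] = [:[:a:]:] + [:[:b:]:]" for a b :: 'a by simp
  show ?thesis
    unfolding homogenize_def coeff_add C by (simp only: sum.distrib distrib_right)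
qed

lemma homogenize_smult: "homogenize X Z (Polynomial.smult c p) D = [:[:c:]:] * homogenize X Z p D"
proof -
  have C: "[:[:a * b:]:] = [:[:a:]:] * [:[:b:]:]" for a b :: 'a by simp
  show ?thesis
    unfolding homogenize_def coeff_smult C by (simp only: sum_distrib_left mult.assoc)
qed

lemma homogenize_sum: "homogenize X Z (\<Sum>i\<in>A. p i) D = (\<Sum>i\<in>A. homogenize X Z (p i) D)"
  by (induction A rule: infinite_finite_induct) (auto simp: homogenize_add)

lemma homogenize_raise:
  assumes "degree p \<le> D"
  shows "homogenize X Z p (D + k) = Z ^ k * homogenize X Z p D"
proof -
  have "homogenize X Z p (D + k) = (\<Sum>i\<le>D. [:[:coeff p i:]:] * X ^ i * Z ^ (D + k - i))"
    unfolding homogenize_def using assms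
    by (intro sum.mono_neutral_right) (auto simp: coeff_eq_0)
  also have "\<dots> = (\<Sum>i\<le>D. Z ^ k * ([:[:coeff p i:]:] * X ^ i * Z ^ (D - i)))"
  proof (rule sum.cong)
    fix i assume "i \<in> {..D}"
    then have "D + k - i = k + (D - i)" by auto
    then show "[:[:coeff p i:]:] * X ^ i * Z ^ (D + k - i) = Z ^ k * ([:[:coeff p i:]:] * X ^ i * Z ^ (D - i))"
      by (simp only: power_add ac_simps)
  qed simp
  finally show ?thesis by (simp only: homogenize_def sum_distrib_left)
qed

lemma homogenize_monom_mult:
  "homogenize X Z (monom 1 k * p) (k + D) = X ^ k * homogenize X Z p D"
proof -
  have "homogenize X Z (monom 1 k * p) m =
      (\<Sum>i\<in>{k..m}. [:[:coeff p (i - k):]:] * X ^ i * Z ^ (m - i))" for m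
    unfolding homogenize_def by (rule sum.mono_neutral_cong_right) (auto simp: coeff_monom_mult)
  also have "(\<Sum>i\<in>{k..k + D}. [:[:coeff p (i - k):]:] * X ^ i * Z ^ (k + D - i)) =
      (\<Sum>i\<le>D. [:[:coeff p i:]:] * X ^ (k + i) * Z ^ (D - i))"
    by (rule sum.reindex_bij_witness[of _ "\<lambda>i. k + i" "\<lambda>i. i - k"]) (auto simp: add.commute)
  finally show ?thesis
    by (simp only: homogenize_def sum_distrib_left power_add ac_simps)
qed

text \<open>Expanding \<open>q\<close> into monomials reduces the product to a shift by
  \<open>X ^ k\<close> and a raise of the degree by \<open>D - k\<close>.\<close>

lemma homogenize_mult:
  assumes q: "degree q \<le> D" and p: "degree p \<le> E"
  shows "homogenize X Z (q * p) (D + E) = homogenize X Z q D * homogenize X Z p E"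
proof -
  have "q * p = (\<Sum>k\<le>D. Polynomial.smult (coeff q k) (monom 1 k * p))"
    by (subst poly_as_sum_of_monoms'[OF q, symmetric])
      (simp add: sum_distrib_right Polynomial.smult_monom flip: Polynomial.mult_smult_left)
  then have "homogenize X Z (q * p) (D + E) =
      (\<Sum>k\<le>D. [:[:coeff q k:]:] * homogenize X Z (monom 1 k * p) (D + E))"
    by (simp only: homogenize_sum homogenize_smult)
  also have "\<dots> = (\<Sum>k\<le>D. [:[:coeff q k:]:] * X ^ k * Z ^ (D - k) * homogenize X Z p E)"
  proof (rule sum.cong)
    fix k assume "k \<in> {..D}"
    then have D: "D + E = k + (E + (D - k))" by simp
    show "[:[:coeff q k:]:] * homogenize X Z (monom 1 k * p) (D + E)
        = [:[:coeff q k:]:] * X ^ k * Z ^ (D - k) * homogenize X Z p E"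
      by (subst D) (simp only: homogenize_monom_mult homogenize_raise[OF p] mult.assoc)
  qed simp
  finally show ?thesis by (simp only: homogenize_def[of X Z q D] sum_distrib_right)
qed

lemma homogenize_power:
  assumes "degree p \<le> D"
  shows "homogenize X Z (p ^ k) (k * D) = homogenize X Z p D ^ k"
proof (induction k)
  case 0
  show ?case by (simp add: homogenize_def flip: one_pCons)
next
  case (Suc k)
  have "degree (p ^ k) \<le> k * D"
    using degree_power_le[of p k] mult_le_mono2[OF assms, of k] by (metis le_trans mult.commute)
  then show ?case using assms Suc by (simp add: homogenize_mult)
qed

text \<open>For \<open>c > 0\<close> this is part number \<open>c\<close> of the conjugate of the
  partition with parts \<open>l d\<close>. At \<open>c = 0\<close> it counts all \<open>N\<close>
  strings, empty ones included.\<close>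

definition string_count :: "nat \<Rightarrow> (nat \<Rightarrow> nat) \<Rightarrow> nat \<Rightarrow> nat" where
  "string_count N l c = card {d. d < N \<and> c \<le> l d}"

text \<open>Euclidean descent: the pair \<open>f, g\<close> of degrees \<open>a \<ge> b\<close> yields the strings that start in
  degrees \<open>b..<a\<close>, all of length \<open>n - a - b\<close>; the pair \<open>g, f mod g\<close> yields the others.\<close>

lemma euclid_strings:
  fixes I :: "'a::field poly poly set"
  assumes ideal: "\<forall>a\<in>I. \<forall>b\<in>I. a + b \<in> I" "\<forall>a. \<forall>b\<in>I. a * b \<in> I"
    and "u * f + v * g = 1" "g \<noteq> 0" "degree g \<le> degree f" "degree f + degree g \<le> n"
    and "Z ^ (n - degree f - degree g) * homogenize X Z f (degree f) \<in> I"
    and "Z ^ (n - degree f - degree g) * homogenize X Z g (degree g) \<in> I"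
  shows "\<exists>w l. (\<forall>d<degree f. degree (w d) = d \<and> w d \<noteq> 0 \<and>
            Z ^ l d * homogenize X Z (w d) d \<in> I \<and> n - degree f - degree g \<le> l d) \<and>
          (\<forall>c. (\<Sum>d | d < degree f \<and> c \<le> l d. int (l d)) =
             int (string_count (degree f) l c) * (int n - int (string_count (degree f) l c)))"
  using assms(3-)
proof (induction "degree g" arbitrary: f g u v rule: less_induct)
  case less
  have add: "a + b \<in> I" if "a \<in> I" "b \<in> I" for a b using ideal(1) that by blast
  have mult: "a * b \<in> I" if "b \<in> I" for a b using ideal(2) that by blast
  let ?a = "degree f" and ?b = "degree g"
  let ?m = "n - ?a - ?b"
  let ?h = "\<lambda>p. homogenize X Z p (degree p)"
  obtain w l where
    w: "\<And>d. d < ?b \<Longrightarrow> degree (w d) = d \<and> w d \<noteq> 0 \<and> Z ^ l d * homogenize X Z (w d) d \<in> I \<and> ?m \<le> l d"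
    and l: "\<And>c. (\<Sum>d | d < ?b \<and> c \<le> l d. int (l d)) =
             int (string_count ?b l c) * (int n - int (string_count ?b l c))"
  proof (cases "?b = 0")
    case True
    then show ?thesis using that[of "\<lambda>_. 0" "\<lambda>_. 0"] by (simp add: string_count_def)
  next
    case False
    define q e where "q = f div g" and "e = f mod g"
    have f: "f = q * g + e" by (simp add: q_def e_def)
    have bez: "(u * q + v) * g + u * e = 1"
      using less.prems(1) by (simp add: f algebra_simps)
    \<comment> \<open>A zero remainder would make \<open>g\<close> divide 1, but \<open>g\<close> is
      not constant here. So the descent ends only at a constant.\<close>
    have e0: "e \<noteq> 0"
    proof
      assume "e = 0"
      then have "g dvd 1" using bez by (metis add.right_neutral dvd_triv_right mult_zero_right)
      then show False using False by (simp add: is_unit_iff_degree less.prems(2))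
    qed
    have eb: "degree e < ?b"
      using degree_mod_less[OF less.prems(2), of f] e0 by (simp add: e_def)
    have q: "degree q \<le> ?a - ?b"
    proof (cases "q = 0")
      case False
      have "degree (q * g) = degree (f - e)" by (simp add: f)
      also have "\<dots> \<le> ?a" using eb less.prems(3) by (intro degree_diff_le) auto
      finally show ?thesis using False less.prems(2) by (simp add: degree_mult_eq)
    qed simp
    let ?k = "?a - degree e"
    \<comment> \<open>The division identity \<open>f = q * g + e\<close>, homogenized in degree
      \<open>?a\<close>; \<open>e\<close> picks up the missing power of \<open>Z\<close>.\<close>
    have "homogenize X Z f ?a = homogenize X Z (q * g) ((?a - ?b) + ?b) + homogenize X Z e (degree e + ?k)"
      using less.prems(3) eb by (simp add: f[symmetric] flip: homogenize_add)
    also have "\<dots> = homogenize X Z q (?a - ?b) * ?h g + Z ^ ?k * ?h e"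
      using q by (simp only: homogenize_mult homogenize_raise order_refl)
    finally have he: "Z ^ ?k * ?h e = ?h f + (- homogenize X Z q (?a - ?b)) * ?h g" by simp
    \<comment> \<open>Passing from \<open>f, g\<close> to \<open>g, e\<close> raises the exponent by
      exactly the power of \<open>Z\<close> in \<open>he\<close>, so \<open>Z ^ ?m\<close> times
      \<open>he\<close> gives membership in \<open>I\<close>.\<close>
    have k: "n - ?b - degree e = ?k + ?m" using eb less.prems(3,4) by simp
    have "Z ^ (n - ?b - degree e) * ?h e = Z ^ ?m * (Z ^ ?k * ?h e)"
      unfolding k power_add by (simp only: ac_simps)
    also have "\<dots> = Z ^ ?m * ?h f + (- homogenize X Z q (?a - ?b)) * (Z ^ ?m * ?h g)"
      unfolding he by (simp only: distrib_left ac_simps)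
    finally have I1: "Z ^ (n - ?b - degree e) * ?h e \<in> I"
      by (simp only:) (intro add mult less.prems(5,6))
    have I2: "Z ^ (n - ?b - degree e) * ?h g \<in> I"
      unfolding k power_add mult.assoc using mult less.prems(6) by blast
    have le: "?m \<le> n - ?b - degree e" using k by simp
    have deg: "degree e \<le> ?b" "?b + degree e \<le> n" using eb less.prems(3,4) by auto
    from less.hyps[OF eb bez e0 deg I2 I1] obtain w l where
      w: "\<forall>d<?b. degree (w d) = d \<and> w d \<noteq> 0 \<and> Z ^ l d * homogenize X Z (w d) d \<in> I \<and>
            n - ?b - degree e \<le> l d"
      and l: "\<forall>c. (\<Sum>d | d < ?b \<and> c \<le> l d. int (l d)) =
             int (string_count ?b l c) * (int n - int (string_count ?b l c))"
      by blast
    show ?thesis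
    proof (rule that)
      fix d assume "d < ?b"
      then show "degree (w d) = d \<and> w d \<noteq> 0 \<and> Z ^ l d * homogenize X Z (w d) d \<in> I \<and> ?m \<le> l d"
        using w le by force
    qed (use l in blast)
  qed
  define w' where "w' d = (if d < ?b then w d else monom 1 (d - ?b) * g)" for d
  define l' where "l' d = (if d < ?b then l d else ?m)" for d
  have w': "degree (w' d) = d \<and> w' d \<noteq> 0 \<and> Z ^ l' d * homogenize X Z (w' d) d \<in> I \<and> ?m \<le> l' d"
    if "d < ?a" for d
  proof (cases "d < ?b")
    case True
    then show ?thesis using w by (simp add: w'_def l'_def)
  next
    case False
    have "homogenize X Z (monom 1 (d - ?b) * g) ((d - ?b) + ?b) = X ^ (d - ?b) * ?h g"
      by (rule homogenize_monom_mult)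
    then have h: "homogenize X Z (w' d) d = X ^ (d - ?b) * ?h g"
      using False by (simp add: w'_def)
    have l: "l' d = ?m" using False by (simp add: l'_def)
    have "Z ^ l' d * homogenize X Z (w' d) d \<in> I"
      unfolding h l mult.left_commute[of "Z ^ ?m"] by (rule mult[OF less.prems(6)])
    then show ?thesis using False less.prems(2)
      by (simp add: l'_def w'_def degree_mult_eq degree_monom_eq)
  qed
  have "(\<Sum>d | d < ?a \<and> c \<le> l' d. int (l' d)) = int (string_count ?a l' c) * (int n - int (string_count ?a l' c))" for c
  proof (cases "c \<le> ?m")
    \<comment> \<open>No string is shorter than \<open>?m\<close>, so all \<open>?a\<close> are
      counted. By the case \<open>c = 0\<close> the old ones have total length
      \<open>b (n - b)\<close>, and
      \<open>b (n - b) + (a - b) (n - a - b) = a (n - a)\<close>.\<close>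
    case True
    have "{d. d < ?b \<and> 0 \<le> l d} = {..<?b}" by auto
    then have l0: "(\<Sum>d<?b. int (l d)) = int ?b * (int n - int ?b)"
      using l[of 0] by (simp add: string_count_def)
    have S: "{d. d < ?a \<and> c \<le> l' d} = {..<?a}" using True w' le_trans by blast
    have "{..<?a} = {..<?b} \<union> {?b..<?a}" using less.prems(3) by auto
    then have "(\<Sum>d<?a. int (l' d)) = (\<Sum>d<?b. int (l' d)) + (\<Sum>d\<in>{?b..<?a}. int (l' d))"
      by (simp add: sum.union_disjoint ivl_disj_int)
    also have "\<dots> = (\<Sum>d<?b. int (l d)) + (\<Sum>d\<in>{?b..<?a}. int ?m)"
      by (intro arg_cong2[of _ _ _ _ "(+)"] sum.cong) (auto simp: l'_def)
    also have "\<dots> = int ?a * (int n - int ?a)"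
      using less.prems(3,4) by (simp add: l0 of_nat_diff algebra_simps)
    finally show ?thesis by (simp add: string_count_def S)
  next
    \<comment> \<open>The new strings, of length \<open>?m < c\<close>, drop out.\<close>
    case False
    then have "{d. d < ?a \<and> c \<le> l' d} = {d. d < ?b \<and> c \<le> l d}"
      using less.prems(3) by (auto simp: l'_def split: if_splits)
    moreover have "(\<Sum>d | d < ?b \<and> c \<le> l d. int (l' d)) = (\<Sum>d | d < ?b \<and> c \<le> l d. int (l d))"
      by (intro sum.cong) (auto simp: l'_def)
    ultimately show ?thesis using l[of c] by (simp add: string_count_def)
  qed
  with w' show ?case by blast
qed

section \<open>Coprimality of the two relations and the ideal \<open>(x^r, y^s)\<close>\<close>

lemma bezout_mult:
  fixes a b c :: "'b::comm_ring_1"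
  assumes "u * a + v * b = 1" "u' * a + v' * c = 1"
  shows "\<exists>u v. u * a + v * (b * c) = 1"
proof -
  have "(u * a + v * b) * (u' * a + v' * c) = 1" using assms by simp
  then have "(u * u' * a + u * v' * c + v * b * u') * a + (v * v') * (b * c) = 1"
    by (simp add: algebra_simps)
  then show ?thesis by blast
qed

lemma bezout_power:
  fixes a b :: "'b::comm_ring_1"
  assumes "u * a + v * b = 1"
  shows "\<exists>u v. u * a + v * b ^ k = 1"
proof (induction k)
  case 0
  show ?case by (intro exI[of _ 0] exI[of _ 1]) simp
next
  case (Suc k)
  then show ?case using bezout_mult[OF assms] by fastforce
qed

text \<open>Starts the Euclidean algorithm: \<open>X + (1 - X) = 1\<close>, and coprimality passes
  to powers of either side.\<close>

lemma bezout_X_one_minus_X: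
  "\<exists>u v. u * monom 1 r + v * [:1, -1:] ^ s = (1 :: 'a::field poly)"
proof -
  have "1 * [:0, 1:] + 1 * [:1, -1:] = (1 :: 'a poly)" by (simp add: one_pCons)
  from bezout_power[OF this, of s] obtain u v :: "'a poly"
    where "v * [:1, -1:] ^ s + u * [:0, 1:] = 1" by (metis add.commute)
  from bezout_power[OF this, of r] show ?thesis
    by (metis add.commute monom_altdef Polynomial.smult_1_left)
qed

definition xy_ideal :: "nat \<Rightarrow> nat \<Rightarrow> 'a::field poly poly set" where
  "xy_ideal r s = {u. \<exists>a b. u = a * [:0, 1:] ^ r + b * [:[:0, 1:]:] ^ s}"

lemma xy_ideal_add:
  assumes "u \<in> xy_ideal r s" "v \<in> xy_ideal r s"
  shows "u + v \<in> xy_ideal r s"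
proof -
  let ?x = "[:0, 1:] ^ r" and ?y = "[:[:0, 1:]:] ^ s"
  obtain a b c d where "u = a * ?x + b * ?y" "v = c * ?x + d * ?y"
    using assms by (auto simp: xy_ideal_def)
  then have "u + v = (a + c) * ?x + (b + d) * ?y" by (simp only: distrib_right ac_simps)
  then show ?thesis unfolding xy_ideal_def by blast
qed

lemma xy_ideal_mult:
  assumes "v \<in> xy_ideal r s"
  shows "u * v \<in> xy_ideal r s"
proof -
  let ?x = "[:0, 1:] ^ r" and ?y = "[:[:0, 1:]:] ^ s"
  obtain c d where "v = c * ?x + d * ?y"
    using assms by (auto simp: xy_ideal_def)
  then have "u * v = (u * c) * ?x + (u * d) * ?y" by (simp only: distrib_left mult.assoc)
  then show ?thesis unfolding xy_ideal_def by blast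
qed

lemma homogenize_X_power: "homogenize X Z (monom 1 r) r = X ^ r"
  using homogenize_monom_mult[of X Z r 1 0] by (simp add: homogenize_def flip: one_pCons)

lemma homogenize_one_minus_X_power: "homogenize X Z ([:1, -1:] ^ s) s = (Z - X) ^ s"
proof -
  have minus: "[:- 1:] = (- 1 :: 'a poly)" by (simp add: one_pCons)
  have "homogenize X Z [:1, -1:] 1 = Z - X"
    by (simp add: homogenize_def minus flip: one_pCons)
  then show ?thesis using homogenize_power[of "[:1, -1:]" 1 X Z s] by simp
qed

text \<open>For \<open>X = x (1 + y)\<close> and \<open>Z = x + y + x y\<close> one has \<open>Z - X = y\<close>, so the relations
  \<open>x\<^sup>r = y\<^sup>s = 0\<close> become \<open>X\<^sup>r = (Z - X)\<^sup>s = 0\<close>, which are homogeneous in \<open>X\<close> and \<open>Z\<close>.\<close>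

definition varX :: "'a::field poly poly" where "varX = [:0, 1:] * [:[:1, 1:]:]"
definition varZ :: "'a::field poly poly" where "varZ = varX + [:[:0, 1:]:]"

text \<open>Euclidean descent with \<open>n = r + s\<close>, larger degree first. The initial
  exponent of \<open>Z\<close> is 0, so the start needs \<open>X ^ r\<close> and
  \<open>(Z - X) ^ s\<close> in the ideal: the first is a multiple of \<open>x ^ r\<close>, the
  second is \<open>y ^ s\<close>. If \<open>r\<close> and \<open>s\<close> differ, the strings of
  the first division step are empty.\<close>

lemma exists_strings:
  assumes "r \<ge> 1" "s \<ge> 1"
  shows "\<exists>w l. (\<forall>d<max r s. degree (w d) = d \<and> w d \<noteq> 0 \<and>
            varZ ^ l d * homogenize varX varZ (w d) d \<in> (xy_ideal r s :: 'a::field poly poly set)) \<and>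
          (\<forall>c. (\<Sum>d | d < max r s \<and> c \<le> l d. int (l d)) =
             int (string_count (max r s) l c) * (int (r + s) - int (string_count (max r s) l c)))"
proof -
  let ?I = "xy_ideal r s :: 'a poly poly set"
  let ?f = "monom 1 r :: 'a poly" and ?g = "[:1, -1:] ^ s :: 'a poly"
  obtain u v where bez: "u * ?f + v * ?g = 1" using bezout_X_one_minus_X by blast
  have df: "degree ?f = r" by (simp add: degree_monom_eq)
  have dg: "degree ?g = s" by (simp add: degree_power_eq)
  have "1 * [:0, 1:] ^ r + 0 * [:[:0, 1:]:] ^ s \<in> ?I" "0 * [:0, 1:] ^ r + 1 * [:[:0, 1:]:] ^ s \<in> ?I"
    unfolding xy_ideal_def by blast+
  then have I: "homogenize varX varZ ?f r \<in> ?I" "homogenize varX varZ ?g s \<in> ?I"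
    by (simp_all only: homogenize_X_power homogenize_one_minus_X_power varZ_def varX_def
        power_mult_distrib mult.commute[of "[:0, 1:] ^ r"] xy_ideal_mult add_diff_cancel_left'
        mult_1 mult_zero_left add_0_left add_0_right)
  have ideal: "\<forall>a\<in>?I. \<forall>b\<in>?I. a + b \<in> ?I" "\<forall>a. \<forall>b\<in>?I. a * b \<in> ?I"
    by (simp_all add: xy_ideal_add xy_ideal_mult)
  note euclid = euclid_strings[OF ideal]
  show ?thesis
  proof (cases "s \<le> r")
    case True
    then show ?thesis
      using euclid[OF bez, of "r + s" varZ varX] I by (simp add: df dg max_def)
  next
    case False
    have bez': "v * ?g + u * ?f = 1" using bez by (simp add: add.commute)
    show ?thesis
      using False euclid[OF bez', of "r + s" varZ varX] I by (simp add: df dg max_def)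
  qed
qed

section \<open>The Kronecker product as multiplication by a polynomial\<close>


text \<open>Coordinates of the class of \<open>u\<close> in \<open>A\<close>, with exponents
  descending: multiplication by \<open>x\<close> then lowers the index, as the superdiagonal of
  \<open>jordan_block\<close> requires.\<close>

definition coeff_vec :: "nat \<Rightarrow> nat \<Rightarrow> 'a::field poly poly \<Rightarrow> 'a vec" where
  "coeff_vec r s u = vec (r * s) (\<lambda>k. coeff (coeff u (r - 1 - k div s)) (s - 1 - k mod s))"

lemma coeff_vec_carrier [simp]: "coeff_vec r s u \<in> carrier_vec (r * s)"
  by (simp add: coeff_vec_def)

lemma coeff_vec_add: "coeff_vec r s (u + v) = coeff_vec r s u + coeff_vec r s v"
  by (auto simp: coeff_vec_def)

lemma coeff_vec_smult: "coeff_vec r s ([:[:c:]:] * u) = c \<cdot>\<^sub>v coeff_vec r s u"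
  by (auto simp: coeff_vec_def)

lemma index_div_mod_less:
  fixes k r s :: nat
  assumes "k < r * s"
  shows "k div s < r" "k mod s < s"
proof -
  show "k div s < r" using assms by (simp add: less_mult_imp_div_less)
  have "s > 0" using assms by (cases s) auto
  then show "k mod s < s" by simp
qed

text \<open>Only coefficients with x-exponent below \<open>r\<close> and y-exponent below
  \<open>s\<close> are read, and those of ideal elements vanish. So \<open>coeff_vec\<close> factors
  through \<open>A\<close>.\<close>

lemma coeff_vec_ideal:
  assumes "u \<in> xy_ideal r s"
  shows "coeff_vec r s u = 0\<^sub>v (r * s)"
proof (rule eq_vecI)
  fix k assume k: "k < dim_vec (0\<^sub>v (r * s) :: 'a vec)"
  then have k': "r - 1 - k div s < r" "s - 1 - k mod s < s"
    using index_div_mod_less[of k r s] by auto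
  obtain a b where u: "u = a * [:0, 1:] ^ r + b * [:[:0, 1:]:] ^ s"
    using assms by (auto simp: xy_ideal_def)
  have x: "[:0, 1:] ^ r = monom (1 :: 'a poly) r"
    by (simp add: monom_altdef)
  have y: "[:[:0, 1:]:] ^ s = [:monom (1::'a) s:]"
  proof (induction s)
    case (Suc s)
    then show ?case by (simp add: monom_Suc)
  qed (simp add: one_pCons)
  have "coeff (b * [:monom 1 s:]) i = monom 1 s * coeff b i" for i
    by (simp add: mult.commute)
  then have "coeff (coeff u (r - 1 - k div s)) (s - 1 - k mod s) = 0"
    using k' by (simp add: u x y mult.commute[of a] coeff_monom_mult)
  then show "coeff_vec r s u $ k = 0\<^sub>v (r * s) $ k"
    using k by (simp add: coeff_vec_def)
qed (simp add: coeff_vec_def)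

lemma coeff_vec_monom:
  assumes "k < r * s"
  shows "coeff_vec r s (monom (monom 1 (s - 1 - k mod s)) (r - 1 - k div s)) = unit_vec (r * s) k"
proof (rule eq_vecI)
  fix l assume "l < dim_vec (unit_vec (r * s) k :: 'a vec)"
  then have l: "l < r * s" by simp
  have diff: "n - 1 - i = n - 1 - j \<longleftrightarrow> i = j" if "i < n" "j < n" for i j n :: nat
    using that by auto
  have "r - 1 - k div s = r - 1 - l div s \<longleftrightarrow> k div s = l div s"
    "s - 1 - k mod s = s - 1 - l mod s \<longleftrightarrow> k mod s = l mod s"
    using index_div_mod_less[OF assms] index_div_mod_less[OF l] diff by blast+
  moreover have "k = l" if "k div s = l div s" "k mod s = l mod s"
    using that by (metis div_mult_mod_eq)
  ultimately show "coeff_vec r s (monom (monom 1 (s - 1 - k mod s)) (r - 1 - k div s)) $ l =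
      unit_vec (r * s) k $ l"
    using l assms by (auto simp: coeff_vec_def)
qed (simp add: coeff_vec_def)

lemma sum_div_mod:
  fixes g :: "nat \<Rightarrow> nat \<Rightarrow> 'b::comm_monoid_add"
  shows "(\<Sum>l<r * s. g (l div s) (l mod s)) = (\<Sum>i<r. \<Sum>j<s. g i j)"
proof -
  have "(\<Sum>i<r. \<Sum>j<s. g i j) = (\<Sum>(i, j)\<in>{..<r} \<times> {..<s}. g i j)"
    by (rule sum.cartesian_product)
  also have "\<dots> = (\<Sum>l<r * s. g (l div s) (l mod s))"
  proof (rule sum.reindex_bij_witness[of _ "\<lambda>l. (l div s, l mod s)" "\<lambda>(i, j). i * s + j"])
    fix p assume "p \<in> {..<r} \<times> {..<s}"
    then obtain i j where p: "p = (i, j)" "i < r" "j < s" by auto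
    have "Suc i * s \<le> r * s" using p by (intro mult_le_mono1) auto
    then show "(case p of (i, j) \<Rightarrow> i * s + j) \<in> {..<r * s}" using p by auto
  qed (auto simp: index_div_mod_less)
  finally show ?thesis ..
qed

lemma jordan_block_one_sum:
  fixes f :: "nat \<Rightarrow> 'a::field"
  assumes "b < s"
  shows "(\<Sum>j<s. jordan_block s 1 $$ (b, j) * f j) = f b + (if Suc b < s then f (Suc b) else 0)"
proof -
  have "(\<Sum>j<s. jordan_block s 1 $$ (b, j) * f j) =
      (\<Sum>j<s. (if j = b then f j else 0) + (if j = Suc b then f j else 0))"
    using assms by (intro sum.cong) auto
  also have "\<dots> = f b + (if Suc b < s then f (Suc b) else 0)"
    using assms by (simp add: sum.distrib)
  finally show ?thesis .
qed

text \<open>In reversed coordinates, multiplication by \<open>1 + x\<close> has the pattern of a row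
  of a Jordan block. The factor \<open>c\<close> lets one rule serve both variables:
  \<open>c = 1 + y\<close> for \<open>x\<close>, then \<open>c = 1\<close> for
  \<open>y\<close>.\<close>

lemma coeff_linear_mult_reverse:
  fixes c :: "'b::comm_semiring_0"
  assumes "i < n"
  shows "coeff ([:c, c:] * v) (n - 1 - i) =
    c * coeff v (n - 1 - i) + (if Suc i < n then c * coeff v (n - 1 - Suc i) else 0)"
proof (cases "Suc i < n")
  case True
  then have "n - 1 - i = Suc (n - 1 - Suc i)" by simp
  then show ?thesis using True by simp
next
  case False
  then have "n - 1 - i = 0" using assms by simp
  then show ?thesis using False by simp
qed

text \<open>The two Jordan blocks act as multiplication by \<open>1 + x\<close> and
  \<open>1 + y\<close>, and \<open>(1 + x) (1 + y) = 1 + varZ\<close>.\<close>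

lemma kronecker_mult_coeff_vec:
  fixes u :: "'a::field poly poly"
  shows "kronecker_mat (jordan_block r 1) (jordan_block s 1) *\<^sub>v coeff_vec r s u =
    coeff_vec r s u + coeff_vec r s (varZ * u)" (is "?K *\<^sub>v _ = _")
proof (rule eq_vecI)
  fix k assume "k < dim_vec (coeff_vec r s u + coeff_vec r s (varZ * u))"
  then have k: "k < r * s" by (simp add: coeff_vec_def)
  note kk = index_div_mod_less[OF k]
  define a b where "a = k div s" and "b = k mod s"
  have ab: "a < r" "b < s" using kk by (simp_all add: a_def b_def)
  let ?U = "\<lambda>i j. coeff (coeff u (r - 1 - i)) (s - 1 - j)"
  have "(?K *\<^sub>v coeff_vec r s u) $ k =
      (\<Sum>l<r * s. jordan_block r 1 $$ (a, l div s) * (jordan_block s 1 $$ (b, l mod s) * ?U (l div s) (l mod s)))"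
    using k by (simp add: scalar_prod_def kronecker_mat_def coeff_vec_def a_def b_def
        lessThan_atLeast0 mult.assoc)
  also have "\<dots> = (\<Sum>i<r. jordan_block r 1 $$ (a, i) * (\<Sum>j<s. jordan_block s 1 $$ (b, j) * ?U i j))"
    unfolding sum_distrib_left
    by (rule sum_div_mod[of "\<lambda>i j. jordan_block r 1 $$ (a, i) * (jordan_block s 1 $$ (b, j) * ?U i j)"])
  also have "\<dots> = ?U a b + (if Suc b < s then ?U a (Suc b) else 0) +
      (if Suc a < r then ?U (Suc a) b + (if Suc b < s then ?U (Suc a) (Suc b) else 0) else 0)"
    by (simp only: jordan_block_one_sum[OF ab(1)] jordan_block_one_sum[OF ab(2)])
  also have "\<dots> = coeff (coeff ([:[:1, 1:], [:1, 1:]:] * u) (r - 1 - a)) (s - 1 - b)"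
    by (cases "Suc a < r") (simp_all only: coeff_linear_mult_reverse[OF ab(1)]
        coeff_linear_mult_reverse[OF ab(2)] coeff_add if_True if_False add_0_right mult_1)
  also have "[:[:1, 1:], [:1, 1:]:] = (1 + varZ :: 'a poly poly)"
    by (simp add: varZ_def varX_def one_pCons)
  also have "(1 + varZ) * u = u + varZ * u" by (simp only: distrib_right mult_1)
  finally show "(?K *\<^sub>v coeff_vec r s u) $ k = (coeff_vec r s u + coeff_vec r s (varZ * u)) $ k"
    using k by (simp add: coeff_vec_def a_def b_def)
qed (simp add: coeff_vec_def kronecker_mat_def)

section \<open>Matrices with strings as columns\<close>

text \<open>A \<open>four_block_mat\<close> without lower rows is horizontal concatenation; padding
  \<open>K\<close> with empty blocks makes block multiplication applicable.\<close>

lemma mult_hcat: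
  fixes A B :: "'a::field mat"
  assumes K: "K \<in> carrier_mat N N" and A: "A \<in> carrier_mat N a" and B: "B \<in> carrier_mat N b"
  shows "K * four_block_mat A B (0\<^sub>m 0 a) (0\<^sub>m 0 b) = four_block_mat (K * A) (K * B) (0\<^sub>m 0 a) (0\<^sub>m 0 b)"
proof -
  have "K = four_block_mat K (0\<^sub>m N 0) (0\<^sub>m 0 N) (0\<^sub>m 0 0)"
    using K by (intro eq_matI) auto
  then have "K * four_block_mat A B (0\<^sub>m 0 a) (0\<^sub>m 0 b) =
      four_block_mat K (0\<^sub>m N 0) (0\<^sub>m 0 N) (0\<^sub>m 0 0) * four_block_mat A B (0\<^sub>m 0 a) (0\<^sub>m 0 b)"
    by simp
  also have "\<dots> = four_block_mat (K * A) (K * B) (0\<^sub>m 0 a) (0\<^sub>m 0 b)"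
    by (subst mult_four_block_mat[of _ N N _ 0 _ 0 _ _ a _ b]) (use K A B in auto)
  finally show ?thesis .
qed

lemma hcat_mult_diag:
  fixes A B :: "'a::field mat"
  assumes A: "A \<in> carrier_mat N a" and B: "B \<in> carrier_mat N b"
    and J: "J \<in> carrier_mat a a" and J': "J' \<in> carrier_mat b b"
  shows "four_block_mat A B (0\<^sub>m 0 a) (0\<^sub>m 0 b) * four_block_mat J (0\<^sub>m a b) (0\<^sub>m b a) J' =
    four_block_mat (A * J) (B * J') (0\<^sub>m 0 a) (0\<^sub>m 0 b)"
  by (subst mult_four_block_mat[of _ N a _ b _ 0 _ _ a _ b]) (use assms in auto)

primrec chain_mat :: "nat \<Rightarrow> ((nat \<Rightarrow> 'a::field vec) \<times> nat) list \<Rightarrow> 'a mat" where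
  "chain_mat N [] = 0\<^sub>m N 0"
| "chain_mat N (x # xs) = four_block_mat (mat N (snd x) (\<lambda>(i, j). fst x j $ i)) (chain_mat N xs)
     (0\<^sub>m 0 (snd x)) (0\<^sub>m 0 (sum_list (map snd xs)))"

lemma chain_mat_carrier [simp]: "chain_mat N xs \<in> carrier_mat N (sum_list (map snd xs))"
  by (induction xs) auto

lemma chain_mat_range:
  assumes "(c, l) \<in> set xs" "j < l" "c j \<in> carrier_vec N"
  shows "\<exists>q\<in>carrier_vec (sum_list (map snd xs)). chain_mat N xs *\<^sub>v q = c j"
  using assms
proof (induction xs)
  case (Cons x xs)
  let ?n = "sum_list (map snd xs)"
  let ?C = "mat N (snd x) (\<lambda>(i, j). fst x j $ i)"
  have C: "?C \<in> carrier_mat N (snd x)" by simp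
  have mult: "chain_mat N (x # xs) *\<^sub>v (a @\<^sub>v q) = ?C *\<^sub>v a + chain_mat N xs *\<^sub>v q"
    if "a \<in> carrier_vec (snd x)" "q \<in> carrier_vec ?n" for a q
    unfolding chain_mat.simps
    by (subst four_block_mat_mult_vec[OF C chain_mat_carrier zero_carrier_mat zero_carrier_mat that])
      (rule eq_vecI, auto)
  show ?case
  proof (cases "(c, l) = x")
    case True
    have "?C *\<^sub>v unit_vec (snd x) j = c j"
      using Cons.prems True by (auto intro!: eq_vecI)
    moreover have "chain_mat N xs *\<^sub>v 0\<^sub>v ?n = 0\<^sub>v N"
      by (intro eq_vecI) (simp_all add: carrier_matD[OF chain_mat_carrier])
    ultimately have "chain_mat N (x # xs) *\<^sub>v (unit_vec (snd x) j @\<^sub>v 0\<^sub>v ?n) = c j"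
      using Cons.prems(3) by (simp add: mult del: chain_mat.simps)
    then show ?thesis by (intro bexI[of _ "unit_vec (snd x) j @\<^sub>v 0\<^sub>v ?n"]) auto
  next
    case False
    then obtain q where q: "q \<in> carrier_vec ?n" "chain_mat N xs *\<^sub>v q = c j"
      using Cons by auto
    have "?C *\<^sub>v 0\<^sub>v (snd x) = 0\<^sub>v N" by auto
    then have "chain_mat N (x # xs) *\<^sub>v (0\<^sub>v (snd x) @\<^sub>v q) = c j"
      using Cons.prems(3) q by (simp add: mult del: chain_mat.simps)
    then show ?thesis using q by (intro bexI[of _ "0\<^sub>v (snd x) @\<^sub>v q"]) auto
  qed
qed simp

text \<open>By hypothesis \<open>K - 1\<close> sends each vector of a string to its predecessor and
  the first one to 0, just as a Jordan block does with unit vectors. Only the intertwining relation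
  is claimed; that the columns form a basis is shown in
  \<open>similar_kronecker_strings\<close>.\<close>

lemma mult_chain_mat:
  assumes K: "K \<in> carrier_mat N N"
    and "\<And>c l j. (c, l) \<in> set xs \<Longrightarrow> j < l \<Longrightarrow>
      c j \<in> carrier_vec N \<and> K *\<^sub>v c j = c j + (if j = 0 then 0\<^sub>v N else c (j - 1))"
  shows "K * chain_mat N xs = chain_mat N xs * jordan_matrix (map (\<lambda>x. (snd x, 1)) xs)"
  using assms(2)
proof (induction xs)
  case Nil
  show ?case using K by (auto simp: jordan_matrix_def)
next
  case (Cons x xs)
  let ?n = "sum_list (map snd xs)" and ?l = "snd x"
  let ?C = "mat N ?l (\<lambda>(i, j). fst x j $ i)"
  let ?J = "jordan_matrix (map (\<lambda>x. (snd x, 1)) xs) :: 'a mat"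
  have C: "?C \<in> carrier_mat N ?l" by simp
  have "sum_list (map fst (map (\<lambda>x. (snd x, 1 :: 'a)) xs)) = ?n" by (simp add: comp_def)
  then have J: "?J \<in> carrier_mat ?n ?n" and n: "sum_list (map fst (map (\<lambda>x. (snd x, 1 :: 'a)) xs)) = ?n"
    by (metis jordan_matrix_carrier)+
  have "K * ?C = ?C * jordan_block ?l 1"
  proof (rule mat_col_eqI)
    fix j assume "j < dim_col (?C * jordan_block ?l 1)"
    then have j: "j < ?l" and j': "j - 1 < ?l" by simp_all
    have c: "fst x j \<in> carrier_vec N" if "j < ?l" for j
      using Cons.prems[of "fst x" "snd x" j] that by simp
    have col: "col ?C j = fst x j" if "j < ?l" for j
      using that c[OF that] by auto
    have "col (K * ?C) j = fst x j + (if j = 0 then 0\<^sub>v N else fst x (j - 1))"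
      using Cons.prems[of "fst x" "snd x" j] j by (simp only: col_mult2[OF K C j] col) simp
    also have "\<dots> = ?C *\<^sub>v col (jordan_block ?l 1) j"
    proof (rule eq_vecI)
      fix i assume "i < dim_vec (?C *\<^sub>v col (jordan_block ?l 1) j)"
      then have i: "i < N" by simp
      have "(?C *\<^sub>v col (jordan_block ?l 1) j) $ i =
          (\<Sum>m<?l. fst x m $ i * (if m = j then 1 else if Suc m = j then 1 else 0))"
        using i j by (simp add: scalar_prod_def lessThan_atLeast0)
      also have "\<dots> = (\<Sum>m<?l. (if m = j then fst x m $ i else 0) + (if Suc m = j then fst x m $ i else 0))"
        by (intro sum.cong) auto
      also have "\<dots> = fst x j $ i + (if j = 0 then 0 else fst x (j - 1) $ i)"
        using j by (cases j) (simp_all add: sum.distrib)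
      finally show "(fst x j + (if j = 0 then 0\<^sub>v N else fst x (j - 1))) $ i =
          (?C *\<^sub>v col (jordan_block ?l 1) j) $ i"
        using i c[OF j] c[OF j'] by auto
    qed (use c[OF j] c[OF j'] in auto)
    finally show "col (K * ?C) j = col (?C * jordan_block ?l 1) j"
      using j by (simp add: col_mult2[OF C _ j])
  qed (use K in auto)
  moreover have "K * chain_mat N xs = chain_mat N xs * ?J"
    using Cons by auto
  ultimately show ?case
    unfolding chain_mat.simps list.map jordan_matrix_Cons n
    by (simp only: mult_hcat[OF K C chain_mat_carrier] hcat_mult_diag[OF C chain_mat_carrier jordan_block_carrier J])
qed

section \<open>A Jordan basis\<close>


lemma varX_power: "varX ^ i = [:0, 1:] ^ i * [:[:1, 1:] ^ i :: 'a::field poly:]"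
  by (simp only: varX_def power_mult_distrib poly_const_pow)

text \<open>The \<open>w d\<close> are triangular in degree, so all \<open>X ^ d\<close> lie in
  \<open>T\<close>; then so do all \<open>X ^ d * Z ^ k * y ^ j\<close>, since
  \<open>y = Z - X\<close>. As \<open>X = x (1 + y)\<close> with \<open>1 + y\<close> invertible
  modulo \<open>y ^ s\<close>, this yields all monomials in \<open>x\<close> and
  \<open>y\<close>.\<close>

lemma strings_generate:
  fixes T :: "'a::field poly poly set"
  assumes add: "\<And>a b. a \<in> T \<Longrightarrow> b \<in> T \<Longrightarrow> a + b \<in> T"
    and scale: "\<And>c a. a \<in> T \<Longrightarrow> [:[:c:]:] * a \<in> T"
    and Z: "\<And>a. a \<in> T \<Longrightarrow> varZ * a \<in> T"
    and ideal: "xy_ideal r s \<subseteq> T"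
    and w: "\<And>d. d < r \<Longrightarrow> degree (w d) = d \<and> w d \<noteq> 0 \<and> homogenize varX varZ (w d) d \<in> T"
  shows "T = UNIV"
proof -
  let ?x = "[:0, 1:] :: 'a poly poly" and ?y = "[:[:0, 1:]:] :: 'a poly poly"
  have "0 * ?x ^ r + 0 * ?y ^ s \<in> xy_ideal r s" unfolding xy_ideal_def by blast
  then have zero: "0 \<in> T" using ideal by auto
  have sum: "(\<Sum>i\<in>A. f i) \<in> T" if "\<And>i. i \<in> A \<Longrightarrow> f i \<in> T" for A :: "nat set" and f
    using that by (induction A rule: infinite_finite_induct) (auto intro: add zero)
  have neg: "- a \<in> T" if "a \<in> T" for a
  proof -
    have "[:[:- 1 :: 'a:]:] = - 1" by (simp add: one_pCons)
    then show ?thesis using scale[OF that, of "- 1"] by simp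
  qed
  have diff: "a - b \<in> T" if "a \<in> T" "b \<in> T" for a b
    using add[OF that(1) neg[OF that(2)]] by simp
  have Zpow: "varZ ^ k * a \<in> T" if "a \<in> T" for k a
    using that by (induction k) (auto simp: mult.assoc intro: Z)
  have ideal_x: "a * ?x ^ r \<in> T" and ideal_y: "a * ?y ^ s \<in> T" for a
  proof -
    have "a * ?x ^ r + 0 * ?y ^ s \<in> xy_ideal r s" "0 * ?x ^ r + a * ?y ^ s \<in> xy_ideal r s"
      unfolding xy_ideal_def by blast+
    then show "a * ?x ^ r \<in> T" "a * ?y ^ s \<in> T" using ideal by auto
  qed
  have X: "varX ^ d \<in> T" for d
  proof (induction d rule: less_induct)
    case (less d)
    show ?case
    proof (cases "d < r")
      case True
      let ?c = "coeff (w d) d"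
      have c: "?c \<noteq> 0" using w[OF True] leading_coeff_0_iff by metis
      have h: "homogenize varX varZ (w d) d =
          (\<Sum>i<d. [:[:coeff (w d) i:]:] * varX ^ i * varZ ^ (d - i)) + [:[:?c:]:] * varX ^ d"
        by (simp add: homogenize_def flip: lessThan_Suc_atMost)
      have S: "(\<Sum>i<d. [:[:coeff (w d) i:]:] * varX ^ i * varZ ^ (d - i)) \<in> T"
      proof (rule sum)
        fix i assume "i \<in> {..<d}"
        then have "[:[:coeff (w d) i:]:] * (varZ ^ (d - i) * varX ^ i) \<in> T"
          using less by (intro scale Zpow) auto
        then show "[:[:coeff (w d) i:]:] * varX ^ i * varZ ^ (d - i) \<in> T"
          by (simp only: ac_simps)
      qed
      have "homogenize varX varZ (w d) d \<in> T" using w[OF True] by blast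
      from diff[OF this S] have "[:[:?c:]:] * varX ^ d \<in> T"
        unfolding h by (simp only: add_diff_cancel_left')
      from scale[OF this, of "inverse ?c"] show ?thesis
        using c by (simp flip: one_pCons)
    next
      case False
      then have "varX ^ d = varX ^ (d - r) * (varX ^ r :: 'a poly poly)" by (simp flip: power_add)
      also have "\<dots> = (varX ^ (d - r) * [:[:1, 1:] ^ r:]) * ?x ^ r"
        by (simp only: varX_power[of r] ac_simps)
      finally show ?thesis using ideal_x by metis
    qed
  qed
  have "varX ^ d * varZ ^ k * (varZ - varX) ^ j \<in> T" for d k j
  proof (induction j arbitrary: d k)
    case 0
    then show ?case using Zpow[OF X[of d], of k] by (simp add: mult.commute)
  next
    case (Suc j)
    have "varX ^ d * varZ ^ k * (varZ - varX) ^ Suc j =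
        varX ^ d * varZ ^ Suc k * (varZ - varX) ^ j - varX ^ Suc d * varZ ^ k * ((varZ - varX) ^ j :: 'a poly poly)"
      by (simp add: algebra_simps)
    then show ?case using diff[OF Suc Suc] by metis
  qed
  moreover have "varZ - varX = ?y" by (simp add: varZ_def)
  ultimately have XZy: "varX ^ d * varZ ^ k * ?y ^ j \<in> T" for d k j by metis
  \<comment> \<open>Instead of inverting \<open>1 + y\<close>, write \<open>h\<close> as
    \<open>h(0) (1 + y)^i + y h'\<close>: the first part gives a scalar multiple of
    \<open>X ^ i * y ^ j\<close>, the second has one more factor \<open>y\<close>. The index
    \<open>k\<close> bounds the steps left until \<open>y ^ s\<close> is reached.\<close>
  have xy: "?x ^ i * ?y ^ j * [:h:] \<in> T" if "s \<le> j + k" for i j k h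
    using that
  proof (induction k arbitrary: j h)
    case 0
    then have "?y ^ j = ?y ^ (j - s) * ?y ^ s" by (simp flip: power_add)
    then have "?x ^ i * ?y ^ j * [:h:] = (?x ^ i * ?y ^ (j - s) * [:h:]) * ?y ^ s"
      by (simp only: ac_simps)
    then show ?case using ideal_y by metis
  next
    case (Suc k)
    let ?c = "poly h 0"
    have "poly (h - Polynomial.smult ?c ([:1, 1:] ^ i)) 0 = 0"
      by simp
    then have "[:0, 1:] dvd h - Polynomial.smult ?c ([:1, 1:] ^ i)"
      by (simp only: poly_eq_0_iff_dvd minus_zero)
    then obtain h' where "h - Polynomial.smult ?c ([:1, 1:] ^ i) = [:0, 1:] * h'"
      by (rule dvdE)
    then have "h = [:?c:] * [:1, 1:] ^ i + [:0, 1:] * h'" by (simp add: algebra_simps)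
    then have "[:h:] = [:[:?c:]:] * [:[:1, 1:] ^ i:] + ?y * [:h':]"
      by simp
    then have "?x ^ i * ?y ^ j * [:h:] =
        [:[:?c:]:] * (varX ^ i * varZ ^ 0 * ?y ^ j) + ?x ^ i * ?y ^ Suc j * [:h':]"
      by (simp only: varX_power power_0 power_Suc mult_1_left mult_1_right distrib_left ac_simps)
    then show ?case
      using add[OF scale[OF XZy[of i 0 j], of ?c] Suc.IH[of "Suc j" h']] Suc.prems by simp
  qed
  have "u \<in> T" for u
  proof -
    have "u = (\<Sum>i\<le>degree u. ?x ^ i * ?y ^ 0 * [:coeff u i:])"
      by (subst poly_as_sum_of_monoms[symmetric]) (simp add: monom_altdef)
    also have "\<dots> \<in> T" by (intro sum xy[of _ s]) simp
    finally show ?thesis .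
  qed
  then show ?thesis by blast
qed

lemma kronecker_mat_carrier:
  "kronecker_mat (jordan_block r 1) (jordan_block s 1) \<in> carrier_mat (r * s) (r * s)"
  by (simp add: kronecker_mat_def)

text \<open>The total length makes the matrix \<open>P\<close> of strings square. By
  \<open>strings_generate\<close> it is onto, hence invertible, and \<open>K P = P J\<close>. Thus
  the bounds \<open>l d\<close> on the string lengths are the exact block sizes.\<close>

lemma similar_kronecker_strings:
  fixes w :: "nat \<Rightarrow> 'a::field poly"
  assumes w: "\<And>d. d < M \<Longrightarrow> degree (w d) = d \<and> w d \<noteq> 0 \<and>
      varZ ^ l d * homogenize varX varZ (w d) d \<in> xy_ideal r s"
    and l: "(\<Sum>d<M. l d) = r * s" and M: "r \<le> M"
  shows "similar_mat (kronecker_mat (jordan_block r 1) (jordan_block s (1::'a)))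
    (jordan_matrix (map (\<lambda>d. (l d, 1)) [0..<M]))"
proof -
  let ?N = "r * s"
  let ?K = "kronecker_mat (jordan_block r 1) (jordan_block s (1::'a))"
  let ?J = "jordan_matrix (map (\<lambda>d. (l d, 1 :: 'a)) [0..<M])"
  define W where "W d = homogenize varX varZ (w d) d" for d
  \<comment> \<open>The end of the string, which \<open>varZ\<close> sends into the ideal, comes
    first; the generator is \<open>c d (l d - 1)\<close>.\<close>
  define c where "c d j = coeff_vec r s (varZ ^ (l d - 1 - j) * W d)" for d j
  define xs where "xs = map (\<lambda>d. (c d, l d)) [0..<M]"
  define P where "P = chain_mat ?N xs"
  have len: "sum_list (map snd xs) = ?N"
    using l by (simp add: xs_def comp_def interv_sum_list_conv_sum_set_nat lessThan_atLeast0)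
  have K: "?K \<in> carrier_mat ?N ?N" by (rule kronecker_mat_carrier)
  have P: "P \<in> carrier_mat ?N ?N" unfolding P_def by (metis len chain_mat_carrier)
  have J: "?J \<in> carrier_mat ?N ?N"
    using jordan_matrix_carrier[of "map (\<lambda>d. (l d, 1 :: 'a)) [0..<M]"] l
    by (simp add: comp_def interv_sum_list_conv_sum_set_nat lessThan_atLeast0)
  have "?K * P = P * jordan_matrix (map (\<lambda>x. (snd x, 1)) xs)"
    unfolding P_def
  proof (rule mult_chain_mat[OF K])
    fix c' l' j assume "(c', l') \<in> set xs" and j: "j < l'"
    then obtain d where d: "d < M" "c' = c d" "l' = l d" by (auto simp: xs_def)
    have "varZ * (varZ ^ (l d - 1 - j) * W d) = varZ ^ (Suc (l d - 1 - j)) * W d"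
      by (simp only: power_Suc mult.assoc)
    moreover have "coeff_vec r s (varZ ^ (Suc (l d - 1 - j)) * W d) = (if j = 0 then 0\<^sub>v ?N else c d (j - 1))"
    proof (cases "j = 0")
      case True
      then show ?thesis using j d w[OF d(1)] by (simp add: coeff_vec_ideal W_def del: power_Suc)
    next
      case False
      then have "Suc (l d - 1 - j) = l d - 1 - (j - 1)" using j d by simp
      then show ?thesis using False by (simp only: c_def if_False)
    qed
    ultimately show "c' j \<in> carrier_vec ?N \<and> ?K *\<^sub>v c' j = c' j + (if j = 0 then 0\<^sub>v ?N else c' (j - 1))"
      unfolding d(2) by (simp only: c_def[of d j] kronecker_mult_coeff_vec coeff_vec_carrier simp_thms)
  qed
  then have KP: "?K * P = P * ?J" by (simp add: xs_def comp_def)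
  define T where "T = {u. \<exists>q\<in>carrier_vec ?N. P *\<^sub>v q = coeff_vec r s u}"
  have T: "T = UNIV"
  proof (rule strings_generate)
    show "a + b \<in> T" if "a \<in> T" "b \<in> T" for a b
    proof -
      from that obtain q q' where "q \<in> carrier_vec ?N" "P *\<^sub>v q = coeff_vec r s a"
        "q' \<in> carrier_vec ?N" "P *\<^sub>v q' = coeff_vec r s b" by (auto simp: T_def)
      then show ?thesis
        by (auto simp: T_def coeff_vec_add mult_add_distrib_mat_vec[OF P] intro!: bexI[of _ "q + q'"])
    qed
    show "[:[:k:]:] * a \<in> T" if "a \<in> T" for k a
    proof -
      from that obtain q where "q \<in> carrier_vec ?N" "P *\<^sub>v q = coeff_vec r s a" by (auto simp: T_def)
      then show ?thesis unfolding T_def mem_Collect_eq coeff_vec_smult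
        by (intro bexI[of _ "k \<cdot>\<^sub>v q"]) (auto simp: mult_mat_vec[OF P])
    qed
    show "varZ * a \<in> T" if "a \<in> T" for a
    proof -
      from that obtain q where q: "q \<in> carrier_vec ?N" "P *\<^sub>v q = coeff_vec r s a" by (auto simp: T_def)
      \<comment> \<open>The range of \<open>P\<close> is stable under \<open>K\<close> by
        \<open>KP\<close>, and \<open>K\<close> acts as \<open>1 + varZ\<close>; subtracting the
        identity gives the preimage \<open>?J q - q\<close>.\<close>
      have "P *\<^sub>v (?J *\<^sub>v q) = coeff_vec r s a + coeff_vec r s (varZ * a)"
        by (simp only: assoc_mult_mat_vec[OF P J q(1), symmetric] KP[symmetric]
            assoc_mult_mat_vec[OF K P q(1)] q(2) kronecker_mult_coeff_vec)
      then have "P *\<^sub>v (?J *\<^sub>v q - q) = coeff_vec r s a + coeff_vec r s (varZ * a) - coeff_vec r s a"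
        using q J by (simp add: mult_minus_distrib_mat_vec[OF P])
      also have "\<dots> = coeff_vec r s (varZ * a)"
        by (auto simp: coeff_vec_def)
      finally show ?thesis unfolding T_def mem_Collect_eq
        using q J by (intro bexI[of _ "?J *\<^sub>v q - q"]) auto
    qed
    show sub: "xy_ideal r s \<subseteq> T"
    proof
      fix u :: "'a poly poly" assume "u \<in> xy_ideal r s"
      then have "P *\<^sub>v 0\<^sub>v ?N = coeff_vec r s u" using P by (simp add: coeff_vec_ideal) auto
      then show "u \<in> T" unfolding T_def mem_Collect_eq by (intro bexI[of _ "0\<^sub>v ?N"]) auto
    qed
    show "degree (w d) = d \<and> w d \<noteq> 0 \<and> homogenize varX varZ (w d) d \<in> T" if "d < r" for d
    proof -
      have d: "d < M" using that M by simp
      have "W d \<in> T"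
      \<comment> \<open>An empty string has no column, but then \<open>W d\<close> itself lies in
        the ideal.\<close>
      proof (cases "l d = 0")
        case True
        then show ?thesis using w[OF d] sub by (auto simp: W_def)
      next
        case False
        have "(c d, l d) \<in> set xs" using d by (auto simp: xs_def)
        from chain_mat_range[OF this, of "l d - 1" ?N] show ?thesis
          using False by (simp add: T_def P_def c_def len)
      qed
      then show ?thesis using w[OF d] by (simp add: W_def)
    qed
  qed
  have "\<exists>q\<in>carrier_vec ?N. P *\<^sub>v q = unit_vec ?N k" if "k < ?N" for k
  proof -
    have "monom (monom 1 (s - 1 - k mod s)) (r - 1 - k div s) \<in> T" by (simp add: T)
    then show ?thesis unfolding T_def by (simp only: mem_Collect_eq coeff_vec_monom[OF that])
  qed
  then obtain q where q: "\<And>k. k < ?N \<Longrightarrow> q k \<in> carrier_vec ?N \<and> P *\<^sub>v q k = unit_vec ?N k"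
    by metis
  define Q where "Q = mat ?N ?N (\<lambda>(i, k). q k $ i)"
  have Q: "Q \<in> carrier_mat ?N ?N" by (simp add: Q_def)
  have PQ: "P * Q = 1\<^sub>m ?N"
  proof (rule mat_col_eqI)
    fix k assume "k < dim_col (1\<^sub>m ?N :: 'a mat)"
    then have k: "k < ?N" by simp
    have "col Q k = q k" using q[OF k] k by (auto simp: Q_def)
    then show "col (P * Q) k = col (1\<^sub>m ?N) k" using q[OF k] k by (simp only: col_mult2[OF P Q k] col_one)
  qed (use P Q in auto)
  have QP: "Q * P = 1\<^sub>m ?N" by (rule mat_mult_left_right_inverse[OF P Q PQ])
  have "P * ?J * Q = ?K * (P * Q)" using K P Q by (simp flip: KP)
  then have "?K = P * ?J * Q" using K by (simp add: PQ)
  then show ?thesis using K J P Q PQ QP by (intro similar_matI[of _ _ P Q ?N]) auto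
qed

lemma jordan_type_kronecker:
  assumes "r \<ge> 1" "s \<ge> 1"
  shows "\<exists>l. similar_mat (kronecker_mat (jordan_block r 1) (jordan_block s (1::'a::field)))
          (jordan_matrix (map (\<lambda>d. (l d, 1)) [0..<max r s])) \<and>
        (\<forall>c. (\<Sum>d | d < max r s \<and> c \<le> l d. int (l d)) =
             int (string_count (max r s) l c) * (int (r + s) - int (string_count (max r s) l c)))"
proof -
  let ?M = "max r s"
  obtain w :: "nat \<Rightarrow> 'a poly" and l where
    w: "\<And>d. d < ?M \<Longrightarrow> degree (w d) = d \<and> w d \<noteq> 0 \<and>
            varZ ^ l d * homogenize varX varZ (w d) d \<in> xy_ideal r s" and
    l: "\<And>c. (\<Sum>d | d < ?M \<and> c \<le> l d. int (l d)) =
             int (string_count ?M l c) * (int (r + s) - int (string_count ?M l c))"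
    using exists_strings[OF assms, where 'a = 'a] by blast
  \<comment> \<open>At \<open>c = 0\<close> all strings count, so the total length is
    \<open>?M (r + s - ?M)\<close>, the maximum of \<open>r\<close> and \<open>s\<close> times their
    minimum.\<close>
  have M: "{d. d < ?M \<and> 0 \<le> l d} = {..<?M}" by auto
  then have "int (\<Sum>d<?M. l d) = int ?M * (int (r + s) - int ?M)"
    using l[of 0] by (simp only: string_count_def of_nat_sum card_lessThan)
  also have "\<dots> = int (r * s)" by (simp add: max_def algebra_simps)
  finally have "(\<Sum>d<?M. l d) = r * s" by (simp only: of_nat_eq_iff)
  from similar_kronecker_strings[OF w this] have "similar_mat (kronecker_mat (jordan_block r 1)
      (jordan_block s (1::'a))) (jordan_matrix (map (\<lambda>d. (l d, 1)) [0..<?M]))"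
    by simp
  then show ?thesis using l by blast
qed

section \<open>From block sizes to multiplicities\<close>


text \<open>If \<open>f x\<close> is a Jordan block size with multiplicity \<open>w x\<close>, then
  \<open>F c\<close> is the dimension of the kernel of the c-th power of the nilpotent part. The
  number and total size of the blocks of size at least \<open>c\<close> follow from \<open>F\<close>
  alone, the latter by splitting \<open>f\<close> as \<open>c + (f - c)\<close>; \<open>F C\<close>
  is the full dimension.\<close>

lemma level_sums:
  fixes w f :: "'i \<Rightarrow> nat"
  assumes A: "finite A" and c: "c > 0" and C: "\<And>x. x \<in> A \<Longrightarrow> f x \<le> C"
  defines "F \<equiv> \<lambda>c. int (\<Sum>x\<in>A. w x * min c (f x))"
  shows "int (\<Sum>x | x \<in> A \<and> c \<le> f x. w x) = F c - F (c - 1)"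
    and "int (\<Sum>x | x \<in> A \<and> c \<le> f x. w x * f x) = F C - F c + int c * (F c - F (c - 1))"
proof -
  show *: "int (\<Sum>x | x \<in> A \<and> c \<le> f x. w x) = F c - F (c - 1)"
    unfolding F_def of_nat_sum sum_subtractf[symmetric] using A
    by (subst sum.inter_filter) (auto intro!: sum.cong simp: min_def c of_nat_diff algebra_simps Suc_le_eq)
  have "int (\<Sum>x | x \<in> A \<and> c \<le> f x. w x * f x) - int c * int (\<Sum>x | x \<in> A \<and> c \<le> f x. w x) =
      int (\<Sum>x | x \<in> A \<and> c \<le> f x. w x * (f x - c))"
    unfolding of_nat_sum sum_distrib_left sum_subtractf[symmetric]
    by (intro sum.cong) (auto simp: of_nat_diff algebra_simps)
  also have "\<dots> = (\<Sum>x\<in>A. int (w x * f x) - int (w x * min c (f x)))"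
    unfolding of_nat_sum using A
    by (subst sum.inter_filter) (auto intro!: sum.cong simp: of_nat_diff algebra_simps min_def)
  also have "\<dots> = F C - F c"
    unfolding F_def of_nat_sum sum_subtractf[symmetric] by (intro sum.cong) (simp_all add: C min_absorb2)
  finally show "int (\<Sum>x | x \<in> A \<and> c \<le> f x. w x * f x) = F C - F c + int c * (F c - F (c - 1))"
    using * by simp
qed

text \<open>Both partitions have the same \<open>F\<close> in \<open>level_sums\<close>, hence equal
  counts and sums at each positive level. The level \<open>c = \<mu> i\<close> selects exactly the
  parts \<open>1..i\<close>, which carries the identity for \<open>l\<close> over to them.\<close>

lemma partition_level_sums:
  fixes l m \<mu> :: "nat \<Rightarrow> nat"
  assumes mins: "\<And>c. (\<Sum>d<M. min c (l d)) = (\<Sum>i\<in>{1..t}. m i * min c (\<mu> i))"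
    and l: "\<And>c. (\<Sum>d | d < M \<and> c \<le> l d. int (l d)) =
             int (string_count M l c) * (n - int (string_count M l c))"
    and \<mu>: "\<And>i. 1 \<le> i \<Longrightarrow> i \<le> t \<Longrightarrow> \<mu> i > 0"
    and dec: "\<And>i j. 1 \<le> i \<Longrightarrow> i < j \<Longrightarrow> j \<le> t \<Longrightarrow> \<mu> i > \<mu> j"
    and i: "i \<le> t"
  shows "(\<Sum>j=1..i. int (m j) * int (\<mu> j)) = (\<Sum>j=1..i. int (m j)) * (n - (\<Sum>j=1..i. int (m j)))"
proof (cases "i = 0")
  case False
  define c where "c = \<mu> i"
  have c: "c > 0" using \<mu> False i by (simp add: c_def)
  define C where "C = Max (l ` {..<M} \<union> \<mu> ` {1..t})"
  have C: "l d \<le> C" if "d \<in> {..<M}" for d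
    unfolding C_def using that by (intro Max_ge) auto
  have C': "\<mu> j \<le> C" if "j \<in> {1..t}" for j
    unfolding C_def using that by (intro Max_ge) auto
  have S: "{j \<in> {1..t}. c \<le> \<mu> j} = {1..i}"
  proof (intro Set.set_eqI iffI)
    fix j assume "j \<in> {j \<in> {1..t}. c \<le> \<mu> j}"
    then show "j \<in> {1..i}" using dec[of i j] False by (force simp: c_def)
  next
    fix j assume "j \<in> {1..i}"
    then show "j \<in> {j \<in> {1..t}. c \<le> \<mu> j}"
      using dec[of j i] i by (cases "j = i") (auto simp: c_def)
  qed
  have L: "{d \<in> {..<M}. c \<le> l d} = {d. d < M \<and> c \<le> l d}" by auto
  have mins': "(\<Sum>d<M. 1 * min c (l d)) = (\<Sum>i\<in>{1..t}. m i * min c (\<mu> i))" for c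
    using mins by simp
  note L1 = level_sums[where A = "{..<M}" and w = "\<lambda>_. 1" and f = l, OF finite_lessThan c C,
      unfolded mins' L]
  note R1 = level_sums[where A = "{1..t}" and w = m and f = \<mu>, OF finite_atLeastAtMost c C',
      unfolded S]
  have "int (string_count M l c) = (\<Sum>j=1..i. int (m j))"
    using L1(1) R1(1) by (simp add: string_count_def)
  moreover have "(\<Sum>d | d < M \<and> c \<le> l d. int (l d)) = (\<Sum>j=1..i. int (m j) * int (\<mu> j))"
    using L1(2) R1(2) by simp
  ultimately show ?thesis using l[of c] by simp
qed simp

lemma sum_list_concat_replicate:
  fixes g :: "'b \<Rightarrow> nat"
  shows "sum_list (map g (concat (map (\<lambda>i. replicate (m i) (f i)) xs))) = (\<Sum>i\<leftarrow>xs. m i * g (f i))"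
  by (induction xs) (auto simp: sum_list_replicate)

text \<open>With \<open>S k = n - 2 (y 1 + ... + y k)\<close> the assumption reads
  \<open>x (k + 1) = S k - y (k + 1)\<close>, so \<open>S (k + 1) = 2 x (k + 1) - S k\<close>;
  unrolling gives the alternating sum.\<close>

lemma multiplicities_from_parts:
  fixes x y :: "nat \<Rightarrow> int"
  assumes x: "\<And>i. i \<in> {1..t} \<Longrightarrow> x i = n - y i - 2 * (\<Sum>j=1..i - 1. y j)" and i: "i \<in> {1..t}"
  shows "y i = (-1) ^ (i - 1) * (n + 2 * (\<Sum>j=1..i - 1. (-1) ^ j * x j)) - x i"
proof -
  have *: "(-1) ^ k * (n + 2 * (\<Sum>j=1..k. (-1) ^ j * x j)) = n - 2 * (\<Sum>j=1..k. y j)" if "k < t" for k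
    using that
  proof (induction k)
    case (Suc k)
    have sq: "(-1 :: int) ^ k * (-1) ^ k = 1" by (simp flip: power_mult_distrib)
    have "(-1) ^ Suc k * (n + 2 * (\<Sum>j=1..Suc k. (-1) ^ j * x j)) =
        - ((-1) ^ k * (n + 2 * (\<Sum>j=1..k. (-1) ^ j * x j))) + 2 * ((-1) ^ k * (-1) ^ k * x (Suc k))"
      by (simp add: algebra_simps)
    also have "\<dots> = - (n - 2 * (\<Sum>j=1..k. y j)) + 2 * x (Suc k)"
      using Suc by (simp add: sq)
    finally show ?case using x[of "Suc k"] Suc.prems by simp
  qed simp
  have "i - 1 < t" using i by auto
  from *[OF this] x[OF i] show ?thesis by linarith
qed

theorem theorem5:
  fixes p n r s t :: nat
    and \<mu> m :: "nat \<Rightarrow> nat"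
  assumes "prime p" and "CHAR('a::field) = p"
    and "r \<ge> 1" and "s \<ge> 1" and "max r s \<le> p ^ n"
    and "\<And>i. 1 \<le> i \<Longrightarrow> i \<le> t \<Longrightarrow> \<mu> i > 0"
    and "\<And>i. 1 \<le> i \<Longrightarrow> i \<le> t \<Longrightarrow> m i > 0"
    and "\<And>i j. 1 \<le> i \<Longrightarrow> i < j \<Longrightarrow> j \<le> t \<Longrightarrow> \<mu> i > \<mu> j"
    and "rep_iso (integer_mod_group (p ^ n))
           (tensor_rep (jordan_rep r) (jordan_rep s) :: int \<Rightarrow> 'a mat)
           (direct_sum_rep (concat (map (\<lambda>i. replicate (m i) (jordan_rep (\<mu> i))) [1..<t + 1])))"
  shows "(\<forall>i\<in>{1..t}. int (\<mu> i) = int r + int s - int (m i) - 2 * (\<Sum>j=1..i - 1. int (m j))) \<and>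
         (\<forall>i\<in>{1..t}. int (m i) =
            (-1) ^ (i - 1) * (int r + int s + 2 * (\<Sum>j=1..i - 1. (-1) ^ j * int (\<mu> j))) - int (\<mu> i))"
proof -
  let ?M = "max r s"
  let ?K = "kronecker_mat (jordan_block r 1) (jordan_block s (1::'a))"
  define bs where "bs = concat (map (\<lambda>i. replicate (m i) (\<mu> i)) [1..<t + 1])"
  let ?J = "jordan_matrix (map (\<lambda>b. (b, 1 :: 'a)) bs)"
  have sum_bs: "(\<Sum>b\<leftarrow>bs. g b) = (\<Sum>i\<in>{1..t}. m i * g (\<mu> i))" for g :: "nat \<Rightarrow> nat"
    by (simp only: bs_def sum_list_concat_replicate interv_sum_list_conv_sum_set_nat
        Suc_eq_plus1[symmetric] set_upt atLeastLessThanSuc_atLeastAtMost)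
  have reps: "concat (map (\<lambda>i. replicate (m i) (jordan_rep (\<mu> i))) [1..<t + 1]) =
      (map jordan_rep bs :: (int \<Rightarrow> 'a mat) list)"
    by (simp add: bs_def map_concat comp_def)
  obtain P Q where PQ: "\<And>g. g \<in> carrier (integer_mod_group (p ^ n)) \<Longrightarrow>
      similar_mat_wit (tensor_rep (jordan_rep r) (jordan_rep s) g :: 'a mat)
        (direct_sum_rep (map jordan_rep bs) g) P Q"
    using assms(9) unfolding reps rep_iso_def by blast
  \<comment> \<open>Evaluate the isomorphism at the generator 1. For \<open>n = 0\<close> the
    carrier is \<open>{0}\<close>; then \<open>r = s = 1\<close>, and the dimension forces all
    blocks to have size at most 1, where identity and Jordan block agree.\<close>
  have "similar_mat ?K ?J"
  proof (cases "n = 0")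
    case False
    have "1 < p ^ n" using False prime_gt_1_nat[OF assms(1)] by (simp only: one_less_power)
    then have "int 1 < int (p ^ n)" by (simp only: of_nat_less_iff)
    then have "(1::int) \<in> carrier (integer_mod_group (p ^ n))"
      using prime_gt_0_nat[OF assms(1)] by (simp add: carrier_integer_mod_group)
    from PQ[OF this] have "similar_mat_wit ?K ?J P Q"
      by (simp add: tensor_rep_def direct_sum_rep_def jordan_rep_def jordan_matrix_def comp_def)
    then show ?thesis unfolding similar_mat_def by blast
  next
    case True
    have rs: "r = 1" "s = 1" using True assms(3-5) by simp_all
    have "(0::int) \<in> carrier (integer_mod_group (p ^ n))"
      using True by (simp add: carrier_integer_mod_group)
    moreover have "tensor_rep (jordan_rep r) (jordan_rep s) 0 = (1\<^sub>m 1 :: 'a mat)"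
      by (auto simp: tensor_rep_def jordan_rep_def rs kronecker_mat_def intro!: eq_matI)
    ultimately have wit: "similar_mat_wit (1\<^sub>m 1) (direct_sum_rep (map jordan_rep bs) 0 :: 'a mat) P Q"
      using PQ by metis
    let ?D = "direct_sum_rep (map jordan_rep bs) 0 :: 'a mat"
    have "dim_row ?D = sum_list bs"
      by (simp add: direct_sum_rep_def dim_diag_block_mat jordan_rep_def comp_def)
    moreover have "?D \<in> carrier_mat 1 1"
      using similar_mat_witD(5)[OF _ wit] by simp
    ultimately have "sum_list bs = 1" by simp
    then have "b \<le> 1" if "b \<in> set bs" for b using member_le_sum_list[OF that] by simp
    then have "jordan_rep b 0 = jordan_block b (1 :: 'a)" if "b \<in> set bs" for b
      using that by (force simp: jordan_rep_def)
    then have "?D = ?J"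
      by (simp add: direct_sum_rep_def jordan_matrix_def comp_def cong: map_cong)
    moreover have "?K = 1\<^sub>m 1" by (auto simp: rs kronecker_mat_def)
    ultimately show ?thesis using wit unfolding similar_mat_def by auto
  qed
  moreover obtain l where
    sim: "similar_mat ?K (jordan_matrix (map (\<lambda>d. (l d, 1)) [0..<?M]))" and
    l: "\<forall>c. (\<Sum>d | d < ?M \<and> c \<le> l d. int (l d)) =
             int (string_count ?M l c) * (int (r + s) - int (string_count ?M l c))"
    using jordan_type_kronecker[OF assms(3,4), where 'a = 'a] by blast
  ultimately have eq: "dim_gen_eigenspace (jordan_matrix (map (\<lambda>d. (l d, 1)) [0..<?M])) (1 :: 'a) =
      dim_gen_eigenspace ?J 1"
    by (simp only: dim_gen_eigenspace_similar[symmetric])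
  \<comment> \<open>A block of size \<open>k\<close> contributes \<open>min c k\<close> to the
    kernel of \<open>(K - 1)^c\<close>, so empty blocks do no harm.\<close>
  have mins: "(\<Sum>d<?M. min c (l d)) = (\<Sum>i\<in>{1..t}. m i * min c (\<mu> i))" for c
    using fun_cong[OF eq, of c]
    by (simp add: dim_gen_eigenspace_jordan_matrix filter_map comp_def sum_bs
        interv_sum_list_conv_sum_set_nat lessThan_atLeast0)
  have sums: "(\<Sum>j=1..i. int (m j) * int (\<mu> j)) =
      (\<Sum>j=1..i. int (m j)) * (int (r + s) - (\<Sum>j=1..i. int (m j)))" if "i \<le> t" for i
    using partition_level_sums[OF mins _ assms(6,8) that, of "int (r + s)"] l by blast
  have parts: "int (\<mu> i) = int r + int s - int (m i) - 2 * (\<Sum>j=1..i - 1. int (m j))"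
    if i: "i \<in> {1..t}" for i
  proof -
    let ?b = "\<Sum>j=1..i - 1. int (m j)"
    obtain k where k: "i = Suc k" using i by (cases i) auto
    \<comment> \<open>The identities \<open>sums\<close> for \<open>i - 1\<close> and
      \<open>i\<close> are subtracted; cancelling \<open>m i > 0\<close> then gives the part
      size.\<close>
    have "(?b + int (m i)) * (int (r + s) - (?b + int (m i))) =
        ?b * (int (r + s) - ?b) + int (m i) * int (\<mu> i)"
      using sums[of k] sums[of i] i by (simp add: k)
    then have "int (m i) * int (\<mu> i) = int (m i) * (int r + int s - int (m i) - 2 * ?b)"
      by (simp add: algebra_simps)
    then show ?thesis using assms(7)[of i] i by simp
  qed
  then show ?thesis
    using multiplicities_from_parts[of t "\<lambda>i. int (\<mu> i)" "int r + int s" "\<lambda>i. int (m i)"] by blast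
qed

end
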